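(* Let $\Psi=(\Sigma,\mathit{ind})$ be a concurrent alphabet with a total order $\le$ on $\Sigma$. If a step sequence $w=A_1\ldots A_k$ over $\Psi$ is in Foata canonical form (for step traces), then the word $lex(w)$ is in Foata canonical form (for sequential traces).
   Context: A concurrent alphabet is $\Psi=(\Sigma,\mathit{ind})$ with $\Sigma$ finite nonempty, $\mathit{ind}$ irreflexive and symmetric, $\mathit{dep}=(\Sigma\times\Sigma)\setminus\mathit{ind}$. Sequential trace equivalence $\equiv^\Sigma_\Psi$ on $\Sigma^*$: reflexive transitive closure of $uabz\sim ubaz$ for $(a,b)\in\mathit{ind}$. A word $w$ is in (sequential) Foata canonical form if $w=w_1\ldots w_n$ ($n\ge0$) with nonempty words $w_i$ such that the letters of each $w_i$ are pairwise independent and $w_i$ is lexicographically ($\le$-) minimal in its class $[w_i]$, and for each $i>1$ and each letter $a$ of $w_i$ there is a letter $b$ of $w_{i-1}$ with $(a,b)\in\mathit{dep}$. Steps over $\Psi$: nonempty sets of pairwise independent actions; $\equiv^{\mathbb{S}}_\Psi$ is the reflexive, symmetric, transitive closure of $uABz\sim u(A\cup B)z$ for steps with $A\times B\subseteq\mathit{ind}$. A step sequence $A_1\ldots A_k$ is in (step) Foata canonical form if for each $i$, whenever $Av\equiv^{\mathbb{S}}_\Psi A_i\ldots A_k$ with $A$ a step, then $A\subseteq A_i$. $lex(A)$ lists the elements of a step $A$ in increasing order; $lex(A_1\ldots A_k)=lex(A_1)\cdots lex(A_k)$. *)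

theory Defs
  imports Main
begin

text \<open>
  An alphabet is a set \<open>\<Sigma>\<close> in a linearly ordered type; the total order on \<open>\<Sigma>\<close> is the
  restriction of the order of the type.
\<close>

definition concurrent_alphabet :: "'a set \<Rightarrow> ('a \<times> 'a) set \<Rightarrow> bool" where
  "concurrent_alphabet \<Sigma> ind \<longleftrightarrow>
     finite \<Sigma> \<and> \<Sigma> \<noteq> {} \<and> ind \<subseteq> \<Sigma> \<times> \<Sigma> \<and> irrefl ind \<and> sym ind"

definition dep :: "'a set \<Rightarrow> ('a \<times> 'a) set \<Rightarrow> ('a \<times> 'a) set" where
  "dep \<Sigma> ind = (\<Sigma> \<times> \<Sigma>) - ind"

inductive swap :: "'a set \<Rightarrow> ('a \<times> 'a) set \<Rightarrow> 'a list \<Rightarrow> 'a list \<Rightarrow> bool"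
  for \<Sigma> ind where
  "\<lbrakk>u \<in> lists \<Sigma>; z \<in> lists \<Sigma>; (a, b) \<in> ind\<rbrakk>
     \<Longrightarrow> swap \<Sigma> ind (u @ [a, b] @ z) (u @ [b, a] @ z)"

definition trace_equiv :: "'a set \<Rightarrow> ('a \<times> 'a) set \<Rightarrow> 'a list \<Rightarrow> 'a list \<Rightarrow> bool" where
  "trace_equiv \<Sigma> ind = (swap \<Sigma> ind)\<^sup>*\<^sup>*"

text \<open>
  Independence of the letters of a word is required between distinct positions, so (\<open>ind\<close> being
  irreflexive) no letter occurs twice.
\<close>

definition indep_word :: "('a \<times> 'a) set \<Rightarrow> 'a list \<Rightarrow> bool" where
  "indep_word ind w \<longleftrightarrow>
     (\<forall>i<length w. \<forall>j<length w. i \<noteq> j \<longrightarrow> (w ! i, w ! j) \<in> ind)"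

definition lex_minimal :: "'a::linorder set \<Rightarrow> ('a \<times> 'a) set \<Rightarrow> 'a list \<Rightarrow> bool" where
  "lex_minimal \<Sigma> ind w \<longleftrightarrow> (\<forall>v. trace_equiv \<Sigma> ind w v \<longrightarrow> lexordp_eq w v)"

definition seq_foata :: "'a::linorder set \<Rightarrow> ('a \<times> 'a) set \<Rightarrow> 'a list \<Rightarrow> bool" where
  "seq_foata \<Sigma> ind w \<longleftrightarrow>
     (\<exists>ws. w = concat ws
        \<and> (\<forall>x\<in>set ws. x \<in> lists \<Sigma> \<and> x \<noteq> [] \<and> indep_word ind x \<and> lex_minimal \<Sigma> ind x)
        \<and> (\<forall>i. Suc i < length ws \<longrightarrow>
             (\<forall>a\<in>set (ws ! Suc i). \<exists>b\<in>set (ws ! i). (a, b) \<in> dep \<Sigma> ind)))"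

definition steps :: "'a set \<Rightarrow> ('a \<times> 'a) set \<Rightarrow> 'a set set" where
  "steps \<Sigma> ind =
     {A. A \<subseteq> \<Sigma> \<and> A \<noteq> {} \<and> (\<forall>a\<in>A. \<forall>b\<in>A. a \<noteq> b \<longrightarrow> (a, b) \<in> ind)}"

inductive step_join :: "'a set \<Rightarrow> ('a \<times> 'a) set \<Rightarrow> 'a set list \<Rightarrow> 'a set list \<Rightarrow> bool"
  for \<Sigma> ind where
  "\<lbrakk>u \<in> lists (steps \<Sigma> ind); z \<in> lists (steps \<Sigma> ind);
    A \<in> steps \<Sigma> ind; B \<in> steps \<Sigma> ind; A \<times> B \<subseteq> ind\<rbrakk>
     \<Longrightarrow> step_join \<Sigma> ind (u @ [A, B] @ z) (u @ [A \<union> B] @ z)"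

definition step_equiv :: "'a set \<Rightarrow> ('a \<times> 'a) set \<Rightarrow> 'a set list \<Rightarrow> 'a set list \<Rightarrow> bool" where
  "step_equiv \<Sigma> ind = equivclp (step_join \<Sigma> ind)"

definition step_foata :: "'a set \<Rightarrow> ('a \<times> 'a) set \<Rightarrow> 'a set list \<Rightarrow> bool" where
  "step_foata \<Sigma> ind w \<longleftrightarrow>
     (\<forall>i<length w. \<forall>A\<in>steps \<Sigma> ind. \<forall>v\<in>lists (steps \<Sigma> ind).
        step_equiv \<Sigma> ind (A # v) (drop i w) \<longrightarrow> A \<subseteq> w ! i)"

definition lex_word :: "'a::linorder set list \<Rightarrow> 'a list" where
  "lex_word w = concat (map sorted_list_of_set w)"

end

theory Submission
  imports Defs "HOL-Library.Multiset"
begin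

text \<open>
  Trace equivalence only permutes letters, so the increasing listing of a step is lexicographically
  minimal in its class. For the condition on consecutive steps \<open>A\<close>, \<open>B\<close>: a letter \<open>a\<close> of \<open>B\<close>
  independent of all of \<open>A\<close> could be split off \<open>B\<close> and joined to \<open>A\<close>, so step canonicity would
  give \<open>a \<in> A\<close>, contradicting irreflexivity of the independence relation.
\<close>

lemma trace_equiv_mset_eq:
  assumes "trace_equiv \<Sigma> ind u v"
  shows "mset u = mset v"
  using assms unfolding trace_equiv_def
  by (induction rule: rtranclp_induct) (auto elim!: swap.cases)

text \<open>The head of a sorted list is the minimum of the multiset that both lists share. If it is
  strictly below the head of \<open>ys\<close>, it decides the comparison; if the heads agree, they
  cancel and the induction goes on.\<close>

lemma sorted_imp_lexordp_eq:
  fixes xs ys :: "'a::linorder list"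
  assumes "sorted xs" "mset xs = mset ys"
  shows "lexordp_eq xs ys"
  using assms
proof (induction xs arbitrary: ys)
  case Nil
  then show ?case by simp
next
  case (Cons x xs)
  then obtain y ys' where ys: "ys = y # ys'"
    by (cases ys) auto
  have "y \<in> set (x # xs)"
    using Cons.prems(2) ys by (metis list.set_intros(1) mset_eq_setD)
  then have "x \<le> y"
    using Cons.prems(1) by auto
  then show ?case
    using Cons ys by (cases "x = y") auto
qed

lemma lex_minimal_sorted:
  assumes "sorted w"
  shows "lex_minimal \<Sigma> ind w"
  using assms sorted_imp_lexordp_eq trace_equiv_mset_eq unfolding lex_minimal_def by blast

lemma indep_word_sorted_list_of_set:
  assumes "A \<in> steps \<Sigma> ind" "finite A"
  shows "indep_word ind (sorted_list_of_set A)"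
  unfolding indep_word_def
proof (intro allI impI)
  fix i j
  let ?w = "sorted_list_of_set A"
  assume *: "i < length ?w" "j < length ?w" "i \<noteq> j"
  then have "?w ! i \<in> A" "?w ! j \<in> A"
    using assms(2) by (metis nth_mem set_sorted_list_of_set)+
  \<comment> \<open>The increasing listing is distinct, so distinct positions carry distinct
    letters.\<close>
  moreover have "?w ! i \<noteq> ?w ! j"
    using * by (simp add: nth_eq_iff_index_eq)
  ultimately show "(?w ! i, ?w ! j) \<in> ind"
    using assms(1) by (auto simp: steps_def)
qed

lemma step_join_Cons_Cons:
  assumes "z \<in> lists (steps \<Sigma> ind)" "A \<in> steps \<Sigma> ind" "B \<in> steps \<Sigma> ind" "A \<times> B \<subseteq> ind"
  shows "step_join \<Sigma> ind (A # B # z) ((A \<union> B) # z)"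
  using step_join.intros[of "[]" \<Sigma> ind z A B] assms by simp

lemma step_join_after_step:
  assumes "z \<in> lists (steps \<Sigma> ind)" "A \<in> steps \<Sigma> ind" "B \<in> steps \<Sigma> ind" "C \<in> steps \<Sigma> ind"
    and "B \<times> C \<subseteq> ind"
  shows "step_join \<Sigma> ind (A # B # C # z) (A # (B \<union> C) # z)"
  using step_join.intros[of "[A]" \<Sigma> ind z B C] assms by simp

text \<open>Splitting \<open>a\<close> off \<open>B\<close> and joining it to \<open>A\<close> keeps
  the step trace. The tail \<open>v\<close> is left open because its shape depends on whether
  \<open>B\<close> has further letters.\<close>

lemma step_equiv_move_letter:
  assumes "sym ind"
    and A: "A \<in> steps \<Sigma> ind" and B: "B \<in> steps \<Sigma> ind" and z: "z \<in> lists (steps \<Sigma> ind)"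
    and a: "a \<in> B" and indep: "A \<times> {a} \<subseteq> ind"
  obtains v where "insert a A \<in> steps \<Sigma> ind" "v \<in> lists (steps \<Sigma> ind)"
    "step_equiv \<Sigma> ind (insert a A # v) (A # B # z)"
proof -
  have Aa: "insert a A \<in> steps \<Sigma> ind"
    using A B a indep \<open>sym ind\<close> by (auto simp: steps_def dest: symD)
  have single: "{a} \<in> steps \<Sigma> ind"
    using B a by (auto simp: steps_def)
  \<comment> \<open>Steps are nonempty, so when \<open>B = {a}\<close> no remainder of
    \<open>B\<close> may be kept.\<close>
  show thesis
  proof (cases "B = {a}")
    case True
    then have "step_join \<Sigma> ind (A # B # z) (insert a A # z)"
      using step_join_Cons_Cons[OF z A single indep] by simp
    then have "step_equiv \<Sigma> ind (insert a A # z) (A # B # z)"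
      unfolding step_equiv_def by (blast intro: equivclp_sym)
    then show thesis
      using that Aa z by blast
  next
    case False
    define C where "C = B - {a}"
    have C: "C \<in> steps \<Sigma> ind" and BC: "{a} \<times> C \<subseteq> ind" and B_eq: "{a} \<union> C = B"
      using B a False by (auto simp: steps_def C_def)
    \<comment> \<open>Both sequences arise by a single join from \<open>A # {a} # C # z\<close>,
      which links them.\<close>
    have "step_join \<Sigma> ind (A # {a} # C # z) (insert a A # C # z)"
      using step_join_Cons_Cons[OF _ A single indep, of "C # z"] z C by simp
    moreover have "step_join \<Sigma> ind (A # {a} # C # z) (A # B # z)"
      using step_join_after_step[OF z A single C BC] unfolding B_eq .
    ultimately have "step_equiv \<Sigma> ind (insert a A # C # z) (A # B # z)"
      unfolding step_equiv_def by (blast intro: equivclp_sym equivclp_trans)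
    then show thesis
      using that[of "C # z"] Aa z C by simp
  qed
qed

lemma step_foata_dep:
  assumes alph: "concurrent_alphabet \<Sigma> ind"
    and w: "w \<in> lists (steps \<Sigma> ind)" and foata: "step_foata \<Sigma> ind w"
    and i: "Suc i < length w" and a: "a \<in> w ! Suc i"
  shows "\<exists>b\<in>w ! i. (a, b) \<in> dep \<Sigma> ind"
proof (rule ccontr)
  assume no_dep: "\<not> ?thesis"
  have sym: "sym ind" and irrefl: "irrefl ind"
    using alph by (auto simp: concurrent_alphabet_def)
  have A: "w ! i \<in> steps \<Sigma> ind" and B: "w ! Suc i \<in> steps \<Sigma> ind"
    using w i by auto
  have z: "drop (Suc (Suc i)) w \<in> lists (steps \<Sigma> ind)"
    using w by (auto dest: in_set_dropD)
  \<comment> \<open>All letters lie in \<open>\<Sigma>\<close>, so not being dependent means being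
    independent; symmetry of \<open>ind\<close> turns the pairs around.\<close>
  have indep: "w ! i \<times> {a} \<subseteq> ind"
    using no_dep A B a sym by (auto simp: dep_def steps_def dest: symD)
  obtain v where "insert a (w ! i) \<in> steps \<Sigma> ind" "v \<in> lists (steps \<Sigma> ind)"
    "step_equiv \<Sigma> ind (insert a (w ! i) # v) (drop i w)"
    using step_equiv_move_letter[OF sym A B z a indep] i
    by (metis Cons_nth_drop_Suc Suc_lessD)
  then have "a \<in> w ! i"
    using foata i unfolding step_foata_def by (meson Suc_lessD insert_subset)
  then show False
    using indep irrefl by (auto simp: irrefl_def)
qed

theorem theorem2p10:
  fixes \<Sigma> :: "'a::linorder set" and ind :: "('a \<times> 'a) set" and w :: "'a set list"
  assumes "concurrent_alphabet \<Sigma> ind"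
    and "w \<in> lists (steps \<Sigma> ind)"
    and "step_foata \<Sigma> ind w"
  shows "seq_foata \<Sigma> ind (lex_word w)"
proof -
  \<comment> \<open>Finiteness is essential here: \<open>sorted_list_of_set\<close> returns the
    empty list on an infinite set.\<close>
  have fin: "finite A" if "A \<in> set w" for A
    using assms(1,2) that unfolding concurrent_alphabet_def steps_def
    by (auto intro: rev_finite_subset)
  \<comment> \<open>The factorization witness has one block per step.\<close>
  let ?ws = "map sorted_list_of_set w"
  have "x \<in> lists \<Sigma> \<and> x \<noteq> [] \<and> indep_word ind x \<and> lex_minimal \<Sigma> ind x" if x: "x \<in> set ?ws" for x
  proof -
    obtain A where A: "A \<in> set w" "x = sorted_list_of_set A"
      using x by auto
    then have "A \<in> steps \<Sigma> ind" "finite A"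
      using assms(2) fin by auto
    then show ?thesis
      using A(2) indep_word_sorted_list_of_set lex_minimal_sorted[of x]
      by (auto simp: steps_def)
  qed
  moreover have "\<exists>b\<in>set (?ws ! i). (a, b) \<in> dep \<Sigma> ind"
    if "Suc i < length ?ws" "a \<in> set (?ws ! Suc i)" for i a
    using step_foata_dep[OF assms, of i a] that fin by simp
  ultimately show ?thesis
    unfolding seq_foata_def lex_word_def by blast
qed

end
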